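(* Let $S(t)$ be a $C^1$ curve in $CS^d_n$ defined on an interval $I$, and let $\Omega$ be an open set in $\mathbb{R}^d$ with $\sigma(S(t))\subset\Omega$ for all $t\in I$. If $f\in C^1(\Omega,\mathbb{R})$ and $F$ is the matrix function induced by $f$, then: (i) $\frac{d}{dt}F(S(t))|_{t=t^*}$ exists for all $t^*\in I$. (ii) If $t^*\in I$ and $T(t)$ is another $C^1$ curve in $CS^d_n$ with $T(0)=S(t^* )$ and $T'(0)=S'(t^* )$, then $$\tfrac{d}{dt}F(T(t))|_{t=0}=\tfrac{d}{dt}F(S(t))|_{t=t^*}.$$
   Context: $CS^d_n$ is the set of $d$-tuples $S=(S^1,\dots,S^d)$ of pairwise-commuting $n\times n$ self-adjoint (complex Hermitian) matrices; a curve in $CS^d_n$ is $C^1$ if it is continuously differentiable as a map into the space of $d$-tuples of self-adjoint matrices. For $S\in CS^d_n$ there is a unitary $U$ with $S^r=U\operatorname{diag}(x_1^r,\dots,x_n^r)U^*$ for all $1\le r\le d$; the joint spectrum is $\sigma(S):=\{x_i=(x_i^1,\dots,x_i^d):1\le i\le n\}\subset\mathbb{R}^d$. A function $f:\Omega\to\mathbb{R}$ induces the matrix function $F$ defined on all $S\in CS^d_n$ with $\sigma(S)\subset\Omega$ by $F(S):=U\operatorname{diag}(f(x_1),\dots,f(x_n))U^*$. *)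

theory Defs
  imports "HOL-Analysis.Analysis"
begin

definition adjoint_mat :: "complex^'n^'m \<Rightarrow> complex^'m^'n" where
  "adjoint_mat A = (\<chi> i j. cnj (A $ j $ i))"

definition self_adjoint :: "complex^'n^'n \<Rightarrow> bool" where
  "self_adjoint A \<longleftrightarrow> adjoint_mat A = A"

definition unitary :: "complex^'n^'n \<Rightarrow> bool" where
  "unitary U \<longleftrightarrow> adjoint_mat U ** U = mat 1 \<and> U ** adjoint_mat U = mat 1"

definition diag_mat :: "('n \<Rightarrow> real) \<Rightarrow> complex^'n^'n" where
  "diag_mat x = (\<chi> i j. if i = j then complex_of_real (x i) else 0)"

definition CS :: "((complex^'n^'n)^'d) set" where
  "CS = {S. (\<forall>r. self_adjoint (S $ r)) \<and> (\<forall>r s. S $ r ** S $ s = S $ s ** S $ r)}"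

text \<open>The point \<open>x i\<close> collects the \<open>i\<close>-th diagonal entries of the \<open>d\<close> diagonal matrices.\<close>

definition jointly_diagonalizes ::
    "complex^'n^'n \<Rightarrow> ('n \<Rightarrow> real^'d) \<Rightarrow> (complex^'n^'n)^'d \<Rightarrow> bool" where
  "jointly_diagonalizes U x S \<longleftrightarrow>
     unitary U \<and> (\<forall>r. S $ r = U ** diag_mat (\<lambda>i. x i $ r) ** adjoint_mat U)"

text \<open>
  The joint spectrum and the induced matrix function do not depend on the chosen
  diagonalization; see \<open>joint_spectrum_eq\<close> and \<open>matrix_fun_eq\<close> below. Functions on \<open>\<Omega>\<close> are
  represented by total functions; \<open>matrix_fun f S\<close> uses the values of \<open>f\<close> on \<open>joint_spectrum S\<close> only.
\<close>

definition joint_spectrum :: "(complex^'n^'n)^'d \<Rightarrow> (real^'d) set" where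
  "joint_spectrum S = {x i | U x i. jointly_diagonalizes U x S}"

definition matrix_fun :: "(real^'d \<Rightarrow> real) \<Rightarrow> (complex^'n^'n)^'d \<Rightarrow> complex^'n^'n" where
  "matrix_fun f S =
     (THE M. \<exists>U x. jointly_diagonalizes U x S \<and>
                   M = U ** diag_mat (\<lambda>i. f (x i)) ** adjoint_mat U)"

text \<open>
  Derivatives are taken within the interval, so they are one-sided at an endpoint belonging
  to it. Degenerate intervals are excluded: derivatives at an isolated point are not unique.
\<close>

definition nondegenerate_interval :: "real set \<Rightarrow> bool" where
  "nondegenerate_interval I \<longleftrightarrow> is_interval I \<and> (\<exists>a\<in>I. \<exists>b\<in>I. a < b)"

definition C1_curve_in_CS :: "real set \<Rightarrow> (real \<Rightarrow> (complex^'n^'n)^'d) \<Rightarrow> bool" where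
  "C1_curve_in_CS I S \<longleftrightarrow>
     nondegenerate_interval I \<and> (\<forall>t\<in>I. S t \<in> CS) \<and>
     (\<forall>t\<in>I. S differentiable (at t within I)) \<and>
     continuous_on I (\<lambda>t. vector_derivative S (at t within I))"

definition C1_fun_on :: "(real^'d) set \<Rightarrow> (real^'d \<Rightarrow> real) \<Rightarrow> bool" where
  "C1_fun_on \<Omega> f \<longleftrightarrow>
     (\<exists>f' :: real^'d \<Rightarrow> (real^'d) \<Rightarrow>\<^sub>L real.
        (\<forall>x\<in>\<Omega>. (f has_derivative blinfun_apply (f' x)) (at x)) \<and> continuous_on \<Omega> f')"

lemma diag_mat_mult_left: "(diag_mat x ** A) $ i $ j = complex_of_real (x i) * A $ i $ j"
  by (simp add: diag_mat_def matrix_matrix_mult_def if_distrib if_distribR cong: if_cong)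

lemma diag_mat_mult_right: "(A ** diag_mat x) $ i $ j = A $ i $ j * complex_of_real (x j)"
  by (simp add: diag_mat_def matrix_matrix_mult_def if_distrib if_distribR cong: if_cong)

lemma unitary_conj_eq_iff:
  assumes "unitary U" "unitary V"
  shows "U ** A ** adjoint_mat U = V ** B ** adjoint_mat V \<longleftrightarrow>
         (adjoint_mat V ** U) ** A = B ** (adjoint_mat V ** U)" (is "?L \<longleftrightarrow> ?R")
proof
  have U: "adjoint_mat U ** U = mat 1" and V: "adjoint_mat V ** V = mat 1"
    using assms by (auto simp: unitary_def)
  assume ?L
  then have "adjoint_mat V ** (U ** A ** adjoint_mat U) ** U =
             adjoint_mat V ** (V ** B ** adjoint_mat V) ** U" by simp
  then have "adjoint_mat V ** U ** A ** (adjoint_mat U ** U) =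
             (adjoint_mat V ** V) ** B ** adjoint_mat V ** U"
    by (simp only: matrix_mul_assoc)
  then show ?R by (simp add: U V matrix_mul_assoc)
next
  have U: "U ** adjoint_mat U = mat 1" and V: "V ** adjoint_mat V = mat 1"
    using assms by (auto simp: unitary_def)
  assume ?R
  then have "V ** ((adjoint_mat V ** U) ** A) ** adjoint_mat U =
             V ** (B ** (adjoint_mat V ** U)) ** adjoint_mat U" by simp
  then have "(V ** adjoint_mat V) ** U ** A ** adjoint_mat U =
             V ** B ** adjoint_mat V ** (U ** adjoint_mat U)"
    by (simp only: matrix_mul_assoc)
  then show ?L by (simp add: U V)
qed

lemma intertwining_entry_zero:
  assumes "jointly_diagonalizes U x S" "jointly_diagonalizes V y S" "x j \<noteq> y i"
  shows "(adjoint_mat V ** U) $ i $ j = 0"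
proof -
  obtain r where r: "x j $ r \<noteq> y i $ r" using assms(3) by (auto simp: vec_eq_iff)
  have "U ** diag_mat (\<lambda>i. x i $ r) ** adjoint_mat U = V ** diag_mat (\<lambda>i. y i $ r) ** adjoint_mat V"
    and "unitary U" "unitary V"
    using assms by (auto simp: jointly_diagonalizes_def)
  then have "(adjoint_mat V ** U) ** diag_mat (\<lambda>i. x i $ r) =
             diag_mat (\<lambda>i. y i $ r) ** (adjoint_mat V ** U)"
    by (simp add: unitary_conj_eq_iff)
  then have "((adjoint_mat V ** U) ** diag_mat (\<lambda>i. x i $ r)) $ i $ j =
             (diag_mat (\<lambda>i. y i $ r) ** (adjoint_mat V ** U)) $ i $ j"
    by (rule arg_cong)
  then have "(adjoint_mat V ** U) $ i $ j * complex_of_real (x j $ r) =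
             complex_of_real (y i $ r) * (adjoint_mat V ** U) $ i $ j"
    unfolding diag_mat_mult_left diag_mat_mult_right .
  then show ?thesis using r by (simp add: mult.commute)
qed

lemma matrix_fun_eq:
  assumes "jointly_diagonalizes U x S"
  shows "matrix_fun f S = U ** diag_mat (\<lambda>i. f (x i)) ** adjoint_mat U"
proof -
  have "V ** diag_mat (\<lambda>i. f (y i)) ** adjoint_mat V = U ** diag_mat (\<lambda>i. f (x i)) ** adjoint_mat U"
    if V: "jointly_diagonalizes V y S" for V y
  proof -
    have un: "unitary U" "unitary V"
      using assms V by (auto simp: jointly_diagonalizes_def)
    have "(adjoint_mat V ** U) ** diag_mat (\<lambda>i. f (x i)) =
          diag_mat (\<lambda>i. f (y i)) ** (adjoint_mat V ** U)"
    proof -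
      have "(adjoint_mat V ** U) $ i $ j * complex_of_real (f (x j)) =
            complex_of_real (f (y i)) * (adjoint_mat V ** U) $ i $ j" for i j
        using intertwining_entry_zero[OF assms V, of j i] by (cases "x j = y i") auto
      then show ?thesis
        by (simp only: vec_eq_iff diag_mat_mult_left diag_mat_mult_right) simp
    qed
    then show ?thesis
      by (rule unitary_conj_eq_iff[OF un, THEN iffD2, symmetric])
  qed
  note unique = this
  show ?thesis
    unfolding matrix_fun_def
  proof (rule the_equality)
    show "\<exists>V y. jointly_diagonalizes V y S \<and>
            U ** diag_mat (\<lambda>i. f (x i)) ** adjoint_mat U =
            V ** diag_mat (\<lambda>i. f (y i)) ** adjoint_mat V"
      by (rule exI[of _ U], rule exI[of _ x]) (simp add: assms)
  qed (elim exE conjE, simp only: unique)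
qed

lemma joint_spectrum_eq:
  assumes "jointly_diagonalizes U x S"
  shows "joint_spectrum S = range x"
proof -
  have "y i \<in> range x" if V: "jointly_diagonalizes V y S" for V y i
  proof (rule ccontr)
    assume "y i \<notin> range x"
    then have zero: "(adjoint_mat V ** U) $ i $ j = 0" for j
      by (intro intertwining_entry_zero[OF assms V]) (metis rangeI)
    have "U ** adjoint_mat U = mat 1" "adjoint_mat V ** V = mat 1"
      using assms V by (auto simp: jointly_diagonalizes_def unitary_def)
    moreover have "(adjoint_mat V ** U) ** (adjoint_mat U ** V) =
                   adjoint_mat V ** (U ** adjoint_mat U) ** V"
      by (simp only: matrix_mul_assoc)
    ultimately have "(adjoint_mat V ** U) ** (adjoint_mat U ** V) = mat 1"
      by simp
    then have "((adjoint_mat V ** U) ** (adjoint_mat U ** V)) $ i $ i = 1"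
      by (simp add: mat_def)
    then show False
      by (subst (asm) matrix_matrix_mult_def) (simp add: zero)
  qed
  then show ?thesis unfolding joint_spectrum_def using assms by blast
qed

end

theory Submission
  imports Defs
begin

text \<open>
  Let \<open>A = S(t\<^sup>*)\<close> have the joint eigenbasis \<open>V\<close> with joint eigenvalues \<open>y\<^sub>i\<close>, and let \<open>B = S'(t\<^sup>*)\<close>. The
  derivative of \<open>F(S(t))\<close> at \<open>t\<^sup>*\<close> is given by an explicit formula in \<open>A\<close>, \<open>B\<close> and \<open>f\<close> alone
  (\<open>spectral_derivative\<close>): in the basis \<open>V\<close> its \<open>(i,j)\<close> entry is the sum over \<open>r\<close> of the entries of
  \<open>V\<^sup>* B\<^sup>r V\<close>, weighted by the partial derivatives of \<open>f\<close> at \<open>y\<^sub>i\<close> if \<open>y\<^sub>i = y\<^sub>j\<close>, and by the coordinates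
  of a secant slope of \<open>f\<close> between \<open>y\<^sub>i\<close> and \<open>y\<^sub>j\<close> otherwise. Both parts of the theorem follow from this,
  as a second curve with the same value and velocity produces the same formula.

  To see where the formula comes from, diagonalize \<open>S(t) = U diag(x) U\<^sup>*\<close>, put \<open>W = V\<^sup>* U\<close> and observe
  that \<open>V\<^sup>* (S\<^sup>r(t) - A\<^sup>r) U\<close> has the entries \<open>W\<^sub>i\<^sub>j (x\<^sub>j\<^sup>r - y\<^sub>i\<^sup>r)\<close>, whereas \<open>V\<^sup>* (F(S(t)) - F(A)) U\<close> has the
  entries \<open>W\<^sub>i\<^sub>j (f(x\<^sub>j) - f(y\<^sub>i))\<close>. If \<open>U\<close> tends to \<open>V\<close>, then \<open>x\<^sub>j\<close> tends to \<open>y\<^sub>j\<close>, the first family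
  divided by \<open>t - t\<^sup>*\<close> converges to \<open>V\<^sup>* B\<^sup>r V\<close>, and a first order expansion of \<open>f\<close> transfers this to the
  second family (\<open>difference_quotient_tendsto_spectral_derivative\<close>).

  The unitaries \<open>U\<close> cannot in general be chosen so that they converge as \<open>t\<close> tends to \<open>t\<^sup>*\<close>. But the
  unitary group is compact, so every sequence of times has a subsequence along which they converge to
  some diagonalizing unitary of \<open>A\<close>; which one depends on the subsequence. The formula does not depend
  on that choice (\<open>spectral_derivative_unique\<close>), hence all subsequences have the same limit.
\<close>

section \<open>Simultaneous diagonalization of commuting Hermitian matrices\<close>

lemma adjoint_mat_nth [simp]: "adjoint_mat A $ i $ j = cnj (A $ j $ i)"
  by (simp add: adjoint_mat_def)

lemma unitary_conj_iff_intertwines: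
  assumes "unitary U"
  shows "S = U ** D ** adjoint_mat U \<longleftrightarrow> S ** U = U ** D"
proof
  have *: "adjoint_mat U ** U = mat 1" using assms by (simp add: unitary_def)
  assume "S = U ** D ** adjoint_mat U"
  then have "S ** U = U ** D ** (adjoint_mat U ** U)"
    by (simp add: matrix_mul_assoc)
  then show "S ** U = U ** D" by (simp add: *)
next
  have *: "U ** adjoint_mat U = mat 1" using assms by (simp add: unitary_def)
  assume "S ** U = U ** D"
  then have "U ** D ** adjoint_mat U = S ** (U ** adjoint_mat U)"
    by (simp add: matrix_mul_assoc)
  then show "S = U ** D ** adjoint_mat U" by (simp add: *)
qed

text \<open>
  A maximizer of the Rayleigh quotient on the unit sphere of \<open>W\<close> is an eigenvector. Working in
  real inner product spaces is enough: a Hermitian matrix on \<open>complex^'n\<close> is a symmetric real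
  linear map, and its eigenvalues are real.
\<close>

lemma symmetric_eigenvector:
  fixes H :: "'a::euclidean_space \<Rightarrow> 'a"
  assumes H: "linear H" and sym: "\<And>v w. H v \<bullet> w = v \<bullet> H w"
    and W: "subspace W" "W \<noteq> {0}" and inv: "\<And>w. w \<in> W \<Longrightarrow> H w \<in> W"
  obtains v \<mu> where "v \<in> W" "v \<noteq> 0" "H v = \<mu> *\<^sub>R v"
proof -
  have "0 \<in> W" using W by (simp add: subspace_0)
  then obtain w0 where w0: "w0 \<in> W" "w0 \<noteq> 0" using W by auto
  have "compact (W \<inter> sphere 0 1)"
    using W by (simp add: closed_Int_compact closed_subspace)
  moreover have "(1 / norm w0) *\<^sub>R w0 \<in> W \<inter> sphere 0 1"
    using w0 W by (simp add: subspace_scale)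
  moreover have "continuous_on (W \<inter> sphere 0 1) (\<lambda>w. w \<bullet> H w)"
    by (intro continuous_intros linear_continuous_on) (use H linear_conv_bounded_linear in blast)
  ultimately have "\<exists>v\<in>W \<inter> sphere 0 1. \<forall>w\<in>W \<inter> sphere 0 1. w \<bullet> H w \<le> v \<bullet> H v"
    by (intro continuous_attains_sup) blast+
  then obtain v where v: "v \<in> W" "norm v = 1"
    and max: "\<And>w. w \<in> W \<Longrightarrow> norm w = 1 \<Longrightarrow> w \<bullet> H w \<le> v \<bullet> H v"
    by auto
  define \<mu> where "\<mu> = v \<bullet> H v"
  have form: "w \<bullet> H w \<le> \<mu> * (w \<bullet> w)" if "w \<in> W" for w
  proof (cases "w = 0")
    case False
    define u where "u = (1 / norm w) *\<^sub>R w"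
    have "u \<bullet> H u \<le> \<mu>"
      unfolding \<mu>_def u_def using that False W by (intro max) (auto simp: subspace_scale)
    moreover have "u \<bullet> H u = (w \<bullet> H w) / (w \<bullet> w)"
      unfolding u_def
      by (simp add: linear_scale[OF H] power2_norm_eq_inner[symmetric] power2_eq_square)
    ultimately show ?thesis using False by (simp add: field_simps)
  qed (simp add: linear_0[OF H])
  define e where "e = \<mu> *\<^sub>R v - H v"
  have eW: "e \<in> W" unfolding e_def using W v inv by (simp add: subspace_diff subspace_scale)
  \<comment> \<open>The form \<open>\<mu>|w|\<^sup>2 - w \<bullet> H w\<close> is nonnegative on \<open>W\<close> and vanishes at \<open>v\<close>;
    its values at \<open>v - s e\<close> then force the linear term \<open>|e|\<^sup>2\<close> to vanish.\<close>
  have quad: "2 * s * (e \<bullet> e) \<le> s\<^sup>2 * (\<mu> * (e \<bullet> e) - e \<bullet> H e)" for s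
  proof -
    have "v - s *\<^sub>R e \<in> W" using v eW W by (simp add: subspace_diff subspace_scale)
    from form[OF this]
    have le: "(v - s *\<^sub>R e) \<bullet> (H v - s *\<^sub>R H e) \<le> \<mu> * ((v - s *\<^sub>R e) \<bullet> (v - s *\<^sub>R e))"
      by (simp add: linear_diff[OF H] linear_scale[OF H])
    have 1: "(v - s *\<^sub>R e) \<bullet> (H v - s *\<^sub>R H e) = \<mu> - 2 * s * (e \<bullet> H v) + s\<^sup>2 * (e \<bullet> H e)"
    proof -
      have "v \<bullet> H e = e \<bullet> H v" using sym[of v e] by (simp add: inner_commute)
      then show ?thesis
        by (simp add: inner_diff_left inner_diff_right \<mu>_def power2_eq_square algebra_simps)
    qed
    have 2: "(v - s *\<^sub>R e) \<bullet> (v - s *\<^sub>R e) = 1 - 2 * s * (e \<bullet> v) + s\<^sup>2 * (e \<bullet> e)"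
    proof -
      have "v \<bullet> v = 1" "v \<bullet> e = e \<bullet> v" using v(2) by (simp_all add: norm_eq_1 inner_commute)
      then show ?thesis
        by (simp add: inner_diff_left inner_diff_right power2_eq_square algebra_simps)
    qed
    have "e \<bullet> e = \<mu> * (e \<bullet> v) - e \<bullet> H v"
      by (subst (2) e_def) (simp add: inner_diff_right)
    then have "2 * s * (e \<bullet> e) = 2 * s * (\<mu> * (e \<bullet> v) - e \<bullet> H v)" by (rule arg_cong)
    then show ?thesis
      using le unfolding 1 2 by (simp add: algebra_simps)
  qed
  have "e \<bullet> e \<le> 0"
  proof (rule ccontr)
    define c where "c = \<mu> * (e \<bullet> e) - e \<bullet> H e"
    assume "\<not> e \<bullet> e \<le> 0"
    then have pos: "e \<bullet> e > 0" by (simp only: not_le)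
    (* s is small enough for the quadratic term in s to lose against the linear one *)
    define s where "s = (e \<bullet> e) / (\<bar>c\<bar> + 1)"
    have "s > 0" unfolding s_def using pos by simp
    then have "2 * (e \<bullet> e) \<le> s * c"
      using quad[of s] unfolding c_def[symmetric] power2_eq_square by simp
    also have "\<dots> \<le> s * (\<bar>c\<bar> + 1)" using \<open>s > 0\<close> by (intro mult_left_mono) auto
    also have "\<dots> = e \<bullet> e" unfolding s_def by simp
    finally show False using pos by simp
  qed
  then have "e \<bullet> e = 0" using inner_ge_zero[of e] by linarith
  then have "e = 0" by simp
  then have "H v = \<mu> *\<^sub>R v" by (simp add: e_def)
  moreover have "v \<noteq> 0" using v(2) by auto
  ultimately show ?thesis using v(1) that by blast
qed

text \<open>
  The invariant subspace \<open>W\<close> is shrunk to an eigenspace of one map after the other. Allowing an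
  arbitrary \<open>W\<close> also serves the Gram-Schmidt type induction below, where \<open>W\<close> is the orthogonal
  complement of the eigenvectors found so far.
\<close>

lemma commuting_symmetric_common_eigenvector:
  fixes H :: "'r \<Rightarrow> 'a::euclidean_space \<Rightarrow> 'a"
  assumes fin: "finite R"
    and lin: "\<And>r. r \<in> R \<Longrightarrow> linear (H r)"
    and sym: "\<And>r v w. r \<in> R \<Longrightarrow> H r v \<bullet> w = v \<bullet> H r w"
    and comm: "\<And>r s v. r \<in> R \<Longrightarrow> s \<in> R \<Longrightarrow> H r (H s v) = H s (H r v)"
    and W: "subspace W" "W \<noteq> {0}" and inv: "\<And>r w. r \<in> R \<Longrightarrow> w \<in> W \<Longrightarrow> H r w \<in> W"
  shows "\<exists>v\<in>W. v \<noteq> 0 \<and> (\<forall>r\<in>R. \<exists>\<mu>. H r v = \<mu> *\<^sub>R v)"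
  using fin lin sym comm W inv
proof (induction R arbitrary: W rule: finite_induct)
  case empty
  then show ?case using subspace_0[of W] by auto
next
  case (insert q R)
  have lq: "linear (H q)" using insert.prems(1) by blast
  have "\<And>v w. H q v \<bullet> w = v \<bullet> H q w" and "\<And>w. w \<in> W \<Longrightarrow> H q w \<in> W"
    using insert.prems(2,6) by blast+
  then obtain v \<mu> where v: "v \<in> W" "v \<noteq> 0" "H q v = \<mu> *\<^sub>R v"
    using symmetric_eigenvector[OF lq _ insert.prems(4,5)] by metis
  \<comment> \<open>The eigenspace inherits the invariance because the other maps commute with \<open>H q\<close>.\<close>
  define E where "E = {w \<in> W. H q w = \<mu> *\<^sub>R w}"
  have "subspace E"
    unfolding E_def using insert.prems(4)
    by (intro subspaceI)
      (simp_all add: subspace_0 subspace_add subspace_scale linear_0[OF lq] linear_add[OF lq]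
        linear_scale[OF lq] scaleR_add_right)
  moreover have "E \<noteq> {0}" using v by (auto simp: E_def)
  moreover have "H r w \<in> E" if "r \<in> R" "w \<in> E" for r w
  proof -
    have "H q (H r w) = H r (H q w)" using insert.prems(3) that by blast
    also have "\<dots> = \<mu> *\<^sub>R H r w"
      using that insert.prems(1)[of r] by (simp add: E_def linear_scale)
    finally show ?thesis using that insert.prems(6) by (simp add: E_def)
  qed
  ultimately have "\<exists>w\<in>E. w \<noteq> 0 \<and> (\<forall>r\<in>R. \<exists>\<mu>. H r w = \<mu> *\<^sub>R w)"
    by (intro insert.IH insert.prems(1-3)) (use insert.prems in blast)+
  then obtain w where "w \<in> E" "w \<noteq> 0" "\<forall>r\<in>R. \<exists>\<mu>. H r w = \<mu> *\<^sub>R w"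
    by blast
  then show ?case by (auto simp: E_def)
qed

text \<open>
  The complex inner product is encoded by two real ones: its real part is \<open>v \<bullet> w\<close> and its imaginary
  part is, up to sign, \<open>v \<bullet> imult w\<close>.
\<close>

definition imult :: "complex^'n \<Rightarrow> complex^'n" where
  "imult v = \<i> *s v"

lemma inner_complex_vec: "v \<bullet> w = Re (\<Sum>i\<in>UNIV. cnj (v $ i) * w $ i)" for v w :: "complex^'n"
  by (simp add: inner_vec_def inner_complex_def)

lemma inner_imult_complex_vec: "v \<bullet> imult w = - Im (\<Sum>i\<in>UNIV. cnj (v $ i) * w $ i)"
  unfolding inner_complex_vec imult_def by (simp add: sum_negf[symmetric] algebra_simps)

lemma linear_imult: "linear imult"
  by (rule linearI) (simp_all add: imult_def vec_eq_iff algebra_simps scaleR_conv_of_real[where 'a=complex])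

lemma inner_imult_left: "imult v \<bullet> w = - (v \<bullet> imult w)"
  by (simp add: imult_def inner_vec_def inner_complex_def sum_negf[symmetric])

lemma linear_matrix_vector_complex: "linear (\<lambda>v. A *v v)" for A :: "complex^'n^'n"
  by (rule linearI)
    (simp_all add: vec_eq_iff matrix_vector_mult_def scaleR_sum_right algebra_simps sum.distrib)

lemma matrix_vector_imult: "A *v imult v = imult (A *v v)"
  by (simp add: imult_def vec_eq_iff matrix_vector_mult_def sum_distrib_left algebra_simps)

lemma self_adjoint_inner:
  assumes "self_adjoint A" shows "(A *v v) \<bullet> w = v \<bullet> (A *v w)"
proof -
  have A: "cnj (A $ i $ j) = A $ j $ i" for i j
    using assms unfolding self_adjoint_def by (metis adjoint_mat_nth)
  have "(\<Sum>i\<in>UNIV. cnj ((A *v v) $ i) * w $ i) = (\<Sum>i\<in>UNIV. \<Sum>j\<in>UNIV. cnj (v $ j) * A $ j $ i * w $ i)"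
    by (simp add: matrix_vector_mult_def sum_distrib_left A algebra_simps)
  also have "\<dots> = (\<Sum>i\<in>UNIV. cnj (v $ i) * (A *v w) $ i)"
    by (subst sum.swap) (simp add: matrix_vector_mult_def sum_distrib_left algebra_simps)
  finally show ?thesis by (simp only: inner_complex_vec)
qed

text \<open>
  Fewer than \<open>n\<close> vectors, together with their multiples by \<open>\<i>\<close>, span a real subspace of dimension
  less than \<open>2n\<close>, so a nonzero orthogonal complement is left. It is invariant under all \<open>S $ r\<close>,
  hence contains a further common eigenvector.
\<close>

lemma CS_orthonormal_eigenvectors:
  fixes S :: "(complex^'n^'n)^'d"
  assumes S: "S \<in> CS" and "finite K"
  shows "\<exists>(u :: 'n \<Rightarrow> complex^'n) x.
    (\<forall>i\<in>K. \<forall>j\<in>K. u i \<bullet> u j = (if i = j then 1 else 0) \<and> u i \<bullet> imult (u j) = 0) \<and>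
    (\<forall>i\<in>K. \<forall>r. S $ r *v u i = x i $ r *\<^sub>R u i)"
  using \<open>finite K\<close>
proof (induction K rule: finite_induct)
  case (insert k K)
  have sa: "self_adjoint (S $ r)" for r using S by (simp add: CS_def)
  have comm: "S $ r *v (S $ s *v v) = S $ s *v (S $ r *v v)" for r s v
    using S by (simp add: CS_def matrix_vector_mul_assoc)
  from insert.IH obtain u :: "'n \<Rightarrow> complex^'n" and x where
    u: "\<And>i j. i \<in> K \<Longrightarrow> j \<in> K \<Longrightarrow> u i \<bullet> u j = (if i = j then 1 else 0) \<and> u i \<bullet> imult (u j) = 0"
    and x: "\<And>i r. i \<in> K \<Longrightarrow> S $ r *v u i = x i $ r *\<^sub>R u i"
    by blast
  define W where "W = {w. \<forall>i\<in>K. w \<bullet> u i = 0 \<and> w \<bullet> imult (u i) = 0}"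
  have subW: "subspace W"
    by (auto simp: W_def subspace_def inner_add_left)
  have "W \<noteq> {0}"
  proof -
    define B where "B = u ` K \<union> (imult \<circ> u) ` K"
    have fin: "finite B" using insert by (simp add: B_def)
    have "dim (span B) \<le> card B" by (rule dim_le_card[OF order_refl fin])
    also have "\<dots> \<le> card (u ` K) + card ((imult \<circ> u) ` K)"
      unfolding B_def by (rule card_Un_le)
    also have "\<dots> \<le> card K + card K"
      using insert by (intro add_mono card_image_le) auto
    also have "\<dots> < DIM(complex^'n)"
    proof -
      have "K \<noteq> UNIV" using insert by auto
      then have "card K < CARD('n)" by (intro psubset_card_mono) auto
      then show ?thesis by simp
    qed
    finally have "dim B < DIM(complex^'n)" unfolding dim_span .
    then obtain w where "w \<noteq> 0" "\<And>b. b \<in> span B \<Longrightarrow> orthogonal w b"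
      using orthogonal_to_subspace_exists[of B] by metis
    then show ?thesis
      by (auto simp: W_def B_def orthogonal_def span_base intro!: exI[of _ w])
  qed
  have inv: "S $ r *v w \<in> W" if "w \<in> W" for r w
    using that by (auto simp: W_def self_adjoint_inner[OF sa] x matrix_vector_imult
        linear_scale[OF linear_imult])
  obtain w where w: "w \<in> W" "w \<noteq> 0" "\<And>r. \<exists>\<mu>. S $ r *v w = \<mu> *\<^sub>R w"
    using commuting_symmetric_common_eigenvector[of "UNIV :: 'd set" "\<lambda>r v. S $ r *v v" W]
      linear_matrix_vector_complex self_adjoint_inner[OF sa] comm subW \<open>W \<noteq> {0}\<close> inv
    by auto
  from w(3) obtain \<mu> where \<mu>: "\<And>r. S $ r *v w = \<mu> r *\<^sub>R w" by metis
  define v where "v = (1 / norm w) *\<^sub>R w"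
  have vW: "v \<in> W" unfolding v_def using w subW by (simp add: subspace_scale)
  have vv: "v \<bullet> v = 1" unfolding v_def using w(2)
    by (simp add: power2_norm_eq_inner[symmetric] power2_eq_square)
  have viv: "v \<bullet> imult v = 0"
    using inner_imult_left[of v v] by (simp add: inner_commute)
  have v\<mu>: "S $ r *v v = \<mu> r *\<^sub>R v" for r
    unfolding v_def by (simp add: linear_scale[OF linear_matrix_vector_complex] \<mu>)
  have vu: "v \<bullet> u i = 0" "v \<bullet> imult (u i) = 0" "u i \<bullet> v = 0" "u i \<bullet> imult v = 0" if "i \<in> K" for i
    using vW that inner_imult_left[of "u i" v] by (auto simp: W_def inner_commute)
  show ?case
  proof (intro exI conjI ballI allI)
    fix i j assume "i \<in> insert k K" "j \<in> insert k K"
    then show "(u(k := v)) i \<bullet> (u(k := v)) j = (if i = j then 1 else 0)"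
      and "(u(k := v)) i \<bullet> imult ((u(k := v)) j) = 0"
      using insert.hyps u vv viv vu by auto
  next
    fix i r assume "i \<in> insert k K"
    then show "S $ r *v (u(k := v)) i = (x(k := (\<chi> r. \<mu> r))) i $ r *\<^sub>R (u(k := v)) i"
      using insert.hyps x v\<mu> by auto
  qed
qed simp

lemma CS_jointly_diagonalizable:
  fixes S :: "(complex^'n^'n)^'d"
  assumes "S \<in> CS"
  obtains U x where "jointly_diagonalizes U x S"
proof -
  obtain u :: "'n \<Rightarrow> complex^'n" and x where
    u: "\<And>i j. u i \<bullet> u j = (if i = j then 1 else 0)" "\<And>i j. u i \<bullet> imult (u j) = 0"
    and x: "\<And>i r. S $ r *v u i = x i $ r *\<^sub>R u i"
    using CS_orthonormal_eigenvectors[OF assms finite[of UNIV]] by auto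
  define U :: "complex^'n^'n" where "U = (\<chi> a i. u i $ a)"
  have "(adjoint_mat U ** U) $ i $ j = mat 1 $ i $ j" for i j
    using u(1)[of i j, unfolded inner_complex_vec] u(2)[of i j, unfolded inner_imult_complex_vec]
    by (simp add: matrix_matrix_mult_def U_def complex_eq_iff mat_def)
  then have "adjoint_mat U ** U = mat 1" by (simp add: vec_eq_iff)
  then have U: "unitary U" by (simp add: unitary_def matrix_left_right_inverse1)
  have "S $ r ** U = U ** diag_mat (\<lambda>i. x i $ r)" for r
  proof -
    have "(S $ r ** U) $ a $ i = (U ** diag_mat (\<lambda>i. x i $ r)) $ a $ i" for a i
    proof -
      have "(S $ r ** U) $ a $ i = (S $ r *v u i) $ a"
        by (simp add: matrix_matrix_mult_def matrix_vector_mult_def U_def)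
      then show ?thesis
        unfolding diag_mat_mult_right x by (simp add: U_def scaleR_conv_of_real[where 'a = complex])
    qed
    then show ?thesis by (simp add: vec_eq_iff)
  qed
  then have "jointly_diagonalizes U x S"
    using U by (simp add: jointly_diagonalizes_def unitary_conj_iff_intertwines)
  then show ?thesis by (rule that)
qed

section \<open>Limits of unitary matrices\<close>

lemma tendsto_matrix_mult:
  fixes A :: "'a \<Rightarrow> complex^'n^'m" and B :: "'a \<Rightarrow> complex^'k^'n"
  assumes "(A \<longlongrightarrow> a) F" "(B \<longlongrightarrow> b) F"
  shows "((\<lambda>k. A k ** B k) \<longlongrightarrow> a ** b) F"
  unfolding matrix_matrix_mult_def by (intro tendsto_intros assms)

lemma tendsto_adjoint_mat:
  assumes "(A \<longlongrightarrow> a) F" shows "((\<lambda>k. adjoint_mat (A k)) \<longlongrightarrow> adjoint_mat a) F"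
  unfolding adjoint_mat_def by (intro tendsto_intros assms)

lemma tendsto_vec_nth_nth:
  assumes "(A \<longlongrightarrow> a) F" shows "((\<lambda>k. A k $ i $ j) \<longlongrightarrow> a $ i $ j) F"
  by (intro tendsto_intros assms)

lemma unitary_entry_le_1:
  assumes "unitary U" shows "norm (U $ i $ j) \<le> 1"
proof -
  have "(adjoint_mat U ** U) $ j $ j = 1"
    using assms by (simp add: unitary_def mat_def)
  then have "(\<Sum>a\<in>UNIV. cnj (U $ a $ j) * U $ a $ j) = 1"
    by (simp add: matrix_matrix_mult_def)
  then have "Re (\<Sum>a\<in>UNIV. cnj (U $ a $ j) * U $ a $ j) = 1" by simp
  moreover have "Re (\<Sum>a\<in>UNIV. cnj (U $ a $ j) * U $ a $ j) = (\<Sum>a\<in>UNIV. (norm (U $ a $ j))\<^sup>2)"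
    by (simp add: cmod_power2) (simp add: power2_eq_square)
  moreover have "(norm (U $ i $ j))\<^sup>2 \<le> (\<Sum>a\<in>UNIV. (norm (U $ a $ j))\<^sup>2)"
    by (rule member_le_sum) auto
  ultimately show ?thesis by (simp add: power2_le_imp_le abs_square_le_1)
qed

text \<open>
  Diagonalizing unitaries of \<open>S t\<close> need not depend continuously on \<open>t\<close>; compactness of the
  unitary group replaces the missing continuity.
\<close>

lemma unitary_convergent_subsequence:
  fixes U :: "nat \<Rightarrow> complex^'n^'n"
  assumes "\<And>k. unitary (U k)"
  obtains V \<phi> where "strict_mono \<phi>" "(U \<circ> \<phi>) \<longlonglongrightarrow> V" "unitary V"
proof -
  have "norm (U k) \<le> (\<Sum>i::'n\<in>UNIV. \<Sum>j::'n\<in>UNIV. 1)" for k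
  proof -
    have "norm (U k) \<le> (\<Sum>i\<in>UNIV. norm (U k $ i))"
      unfolding norm_vec_def by (rule L2_set_le_sum) simp
    also have "\<dots> \<le> (\<Sum>i\<in>UNIV. \<Sum>j\<in>UNIV. norm (U k $ i $ j))"
      unfolding norm_vec_def[where 'a = complex] by (intro sum_mono L2_set_le_sum) simp
    also have "\<dots> \<le> (\<Sum>i::'n\<in>UNIV. \<Sum>j::'n\<in>UNIV. 1)"
      by (intro sum_mono unitary_entry_le_1 assms)
    finally show ?thesis .
  qed
  then have "bounded (range U)" by (auto intro!: boundedI)
  then obtain V \<phi> where \<phi>: "strict_mono \<phi>" and V: "(U \<circ> \<phi>) \<longlonglongrightarrow> V"
    using bounded_imp_convergent_subsequence by blast
  have "(\<lambda>k. adjoint_mat ((U \<circ> \<phi>) k) ** (U \<circ> \<phi>) k) \<longlonglongrightarrow> adjoint_mat V ** V"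
    and "(\<lambda>k. (U \<circ> \<phi>) k ** adjoint_mat ((U \<circ> \<phi>) k)) \<longlonglongrightarrow> V ** adjoint_mat V"
    by (intro tendsto_matrix_mult tendsto_adjoint_mat V)+
  then have "unitary V"
    using assms by (simp add: unitary_def LIMSEQ_const_iff)
  with \<phi> V show ?thesis by (rule that)
qed

section \<open>The derivative formula\<close>

text \<open>
  For \<open>a \<noteq> b\<close> this is the linear functional of least norm that takes the value \<open>f b - f a\<close> at
  \<open>b - a\<close>. It is determined by the two points and the values there, which makes the derivative formula
  independent of the diagonalization in which it is written.
\<close>

definition spectral_slope ::
    "('a::real_inner \<Rightarrow> real) \<Rightarrow> ('a \<Rightarrow> 'a \<Rightarrow> real) \<Rightarrow> 'a \<Rightarrow> 'a \<Rightarrow> 'a \<Rightarrow> real" where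
  "spectral_slope f f' a b v =
     (if a = b then f' a v else (f b - f a) * ((b - a) \<bullet> v) / ((b - a) \<bullet> (b - a)))"

lemma spectral_slope_secant: "a \<noteq> b \<Longrightarrow> spectral_slope f f' a b (b - a) = f b - f a"
  by (simp add: spectral_slope_def)

lemma linear_spectral_slope:
  assumes "linear (f' a)" shows "linear (spectral_slope f f' a b)"
proof (cases "a = b")
  case True
  then have "spectral_slope f f' a b = f' a" by (auto simp: spectral_slope_def)
  then show ?thesis using assms by simp
next
  case False
  then show ?thesis
    by (intro linearI) (simp_all add: spectral_slope_def inner_add_right distrib_left add_divide_distrib)
qed

lemma linear_functional_vec_expansion:
  fixes L :: "real^'d \<Rightarrow> real"
  assumes "linear L"
  shows "L v = (\<Sum>r\<in>UNIV. L (axis r 1) * v $ r)"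
proof -
  have "L v = L (\<Sum>r\<in>UNIV. v $ r *\<^sub>R axis r 1)"
    using basis_expansion[of v] by (simp add: scalar_mult_eq_scaleR)
  then show ?thesis
    by (simp add: linear_sum[OF assms] linear_scale[OF assms] mult.commute)
qed

text \<open>
  In one variable this is the Daletskii-Krein formula: in an eigenbasis, the derivative of the matrix
  function in direction \<open>B\<close> is the entrywise product of \<open>B\<close> with the matrix of divided differences.
\<close>

definition spectral_derivative ::
    "(real^'d \<Rightarrow> real) \<Rightarrow> (real^'d \<Rightarrow> real^'d \<Rightarrow> real) \<Rightarrow> complex^'n^'n \<Rightarrow> ('n \<Rightarrow> real^'d)
      \<Rightarrow> (complex^'n^'n)^'d \<Rightarrow> complex^'n^'n" where
  "spectral_derivative f f' V y B =
     V ** (\<chi> i j. \<Sum>r\<in>UNIV. complex_of_real (spectral_slope f f' (y i) (y j) (axis r 1)) *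
             (adjoint_mat V ** B $ r ** V) $ i $ j) ** adjoint_mat V"

text \<open>
  The matrix \<open>Q = V\<^sup>* U\<close> comparing two diagonalizations only links equal joint eigenvalues, and the
  weights depend only on the values of the eigenvalues. So \<open>Q\<close> intertwines the two weighted matrices,
  because it intertwines the unweighted ones.
\<close>

lemma spectral_derivative_unique:
  fixes A B :: "(complex^'n^'n)^'d"
  assumes U: "jointly_diagonalizes U x A" and V: "jointly_diagonalizes V y A"
  shows "spectral_derivative f f' U x B = spectral_derivative f f' V y B"
proof -
  have un: "unitary U" "unitary V"
    using U V by (auto simp: jointly_diagonalizes_def)
  define Q where "Q = adjoint_mat V ** U"
  have Q0: "Q $ i $ j = 0" if "x j \<noteq> y i" for i j
    unfolding Q_def using intertwining_entry_zero[OF U V that] .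
  define c where "c a b r = complex_of_real (spectral_slope f f' a b (axis r 1))" for a b and r :: 'd
  define G where "G r = adjoint_mat U ** B $ r ** U" for r
  define H where "H r = adjoint_mat V ** B $ r ** V" for r
  have QG: "Q ** G r = H r ** Q" for r
  proof -
    have "Q ** G r = adjoint_mat V ** (U ** adjoint_mat U) ** B $ r ** U"
      unfolding Q_def G_def by (simp only: matrix_mul_assoc)
    also have "\<dots> = adjoint_mat V ** B $ r ** (V ** adjoint_mat V) ** U"
      using un by (simp add: unitary_def)
    also have "\<dots> = H r ** Q"
      unfolding Q_def H_def by (simp only: matrix_mul_assoc)
    finally show ?thesis .
  qed
  have "Q ** (\<chi> i j. \<Sum>r\<in>UNIV. c (x i) (x j) r * G r $ i $ j) =
        (\<chi> i j. \<Sum>r\<in>UNIV. c (y i) (y j) r * H r $ i $ j) ** Q" (is "?L = ?R")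
  proof -
    have "?L $ i $ j = ?R $ i $ j" for i j
    proof -
      have "?L $ i $ j = (\<Sum>k\<in>UNIV. \<Sum>r\<in>UNIV. Q $ i $ k * (c (x k) (x j) r * G r $ k $ j))"
        by (simp add: matrix_matrix_mult_def sum_distrib_left)
      (* a nonzero Q $ i $ k forces x k = y i, which makes the weight independent of k *)
      also have "\<dots> = (\<Sum>k\<in>UNIV. \<Sum>r\<in>UNIV. c (y i) (x j) r * (Q $ i $ k * G r $ k $ j))"
      proof (intro sum.cong refl)
        fix k r
        show "Q $ i $ k * (c (x k) (x j) r * G r $ k $ j) = c (y i) (x j) r * (Q $ i $ k * G r $ k $ j)"
          using Q0[of k i] by (cases "x k = y i") auto
      qed
      also have "\<dots> = (\<Sum>r\<in>UNIV. c (y i) (x j) r * (Q ** G r) $ i $ j)"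
        by (subst sum.swap) (simp add: matrix_matrix_mult_def sum_distrib_left)
      also have "\<dots> = (\<Sum>k\<in>UNIV. \<Sum>r\<in>UNIV. c (y i) (x j) r * (H r $ i $ k * Q $ k $ j))"
        unfolding QG by (subst sum.swap) (simp add: matrix_matrix_mult_def sum_distrib_left)
      also have "\<dots> = (\<Sum>k\<in>UNIV. \<Sum>r\<in>UNIV. c (y i) (y k) r * H r $ i $ k * Q $ k $ j)"
      proof (intro sum.cong refl)
        fix k r
        show "c (y i) (x j) r * (H r $ i $ k * Q $ k $ j) = c (y i) (y k) r * H r $ i $ k * Q $ k $ j"
          using Q0[of j k] by (cases "x j = y k") auto
      qed
      also have "\<dots> = ?R $ i $ j"
        by (simp add: matrix_matrix_mult_def sum_distrib_right)
      finally show ?thesis .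
    qed
    then show ?thesis by (simp only: vec_eq_iff) simp
  qed
  then show ?thesis
    unfolding spectral_derivative_def c_def[symmetric] G_def[symmetric] H_def[symmetric]
      unitary_conj_eq_iff[OF un] Q_def .
qed

section \<open>Differentiability of the induced matrix function\<close>

lemma matrix_diff_ldistrib: "A ** (B - C) = A ** B - A ** C"
  for A :: "complex^'n^'m" and B C :: "complex^'k^'n"
  by (simp add: vec_eq_iff matrix_matrix_mult_def algebra_simps sum_subtractf)

lemma matrix_diff_rdistrib: "(A - B) ** C = A ** C - B ** C"
  for A B :: "complex^'n^'m" and C :: "complex^'k^'n"
  by (simp add: vec_eq_iff matrix_matrix_mult_def algebra_simps sum_subtractf)

text \<open>
  Both matrices are seen through an eigenbasis of their own, \<open>V\<close> on the left and \<open>U\<close> on the right, so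
  that the entries separate into eigenvalue differences and the overlaps \<open>V\<^sup>* U\<close>. The identity is used
  for the matrices of the two tuples and also for their images under the matrix function, with the
  same overlaps.
\<close>

lemma unitary_conj_diff_entry:
  assumes "unitary U" "unitary V"
  shows "(adjoint_mat V ** (U ** diag_mat d ** adjoint_mat U - V ** diag_mat e ** adjoint_mat V) ** U)
           $ i $ j = (adjoint_mat V ** U) $ i $ j * complex_of_real (d j - e i)"
proof -
  let ?W = "adjoint_mat V ** U"
  have "adjoint_mat V ** (U ** diag_mat d ** adjoint_mat U - V ** diag_mat e ** adjoint_mat V) ** U
    = ?W ** diag_mat d ** (adjoint_mat U ** U) - (adjoint_mat V ** V) ** diag_mat e ** ?W"
    by (simp only: matrix_diff_ldistrib matrix_diff_rdistrib matrix_mul_assoc)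
  also have "\<dots> = ?W ** diag_mat d - diag_mat e ** ?W"
    using assms by (simp add: unitary_def)
  finally have eq: "adjoint_mat V **
      (U ** diag_mat d ** adjoint_mat U - V ** diag_mat e ** adjoint_mat V) ** U
    = ?W ** diag_mat d - diag_mat e ** ?W" .
  show ?thesis
    unfolding eq by (simp add: diag_mat_mult_left diag_mat_mult_right algebra_simps)
qed

text \<open>
  The Taylor remainder is \<open>o(|z k - a|)\<close>, and \<open>|z k - a|\<close> is \<open>O(h k)\<close> by the existence of \<open>\<xi>\<close>.
\<close>

lemma difference_quotient_remainder:
  fixes f :: "'a::real_normed_vector \<Rightarrow> real"
  assumes f: "(f has_derivative L) (at a)"
    and z: "z \<longlonglongrightarrow> a" and quot: "(\<lambda>k. (1 / h k) *\<^sub>R (z k - a)) \<longlonglongrightarrow> \<xi>"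
  shows "(\<lambda>k. (f (z k) - f a - L (z k - a)) / h k) \<longlonglongrightarrow> 0"
proof -
  define R where "R w = norm (f w - f a - L (w - a)) / norm (w - a)" for w
  have "(R \<longlongrightarrow> R a) (at a)"
    using f unfolding has_derivative_iff_norm R_def by simp
  then have "(\<lambda>k. R (z k)) \<longlonglongrightarrow> R a"
    using z isCont_tendsto_compose[of a R z] unfolding isCont_def by blast
  moreover have "R a = 0" by (simp add: R_def)
  ultimately have "(\<lambda>k. R (z k) * norm ((1 / h k) *\<^sub>R (z k - a))) \<longlonglongrightarrow> 0 * norm \<xi>"
    by (intro tendsto_intros quot) simp
  moreover have "R (z k) * norm ((1 / h k) *\<^sub>R (z k - a)) = norm ((f (z k) - f a - L (z k - a)) / h k)" for k
  proof (cases "z k = a")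
    case True
    have "L 0 = 0" using f by (simp add: has_derivative_linear linear_0)
    then show ?thesis using True by (simp add: R_def)
  qed (simp add: R_def)
  ultimately have "(\<lambda>k. norm ((f (z k) - f a - L (z k - a)) / h k)) \<longlonglongrightarrow> 0" by (simp del: real_norm_def)
  then show ?thesis by (rule tendsto_norm_zero_cancel)
qed

text \<open>
  The diagonal matrices \<open>U\<^sup>* C U\<close> converge to \<open>V\<^sup>* A V\<close>, which is therefore diagonal.
  This numbers the eigenvalues of \<open>A\<close> compatibly with those along the sequence.
\<close>

lemma spectrum_tendsto:
  fixes A :: "(complex^'n^'n)^'d"
  assumes jd: "\<And>k. jointly_diagonalizes (U k) (x k) (C k)"
    and U: "U \<longlonglongrightarrow> V" and V: "unitary V" and C: "C \<longlonglongrightarrow> A"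
  obtains y where "jointly_diagonalizes V y A" "\<And>j. (\<lambda>k. x k j) \<longlonglongrightarrow> y j"
proof -
  define N where "N r = adjoint_mat V ** A $ r ** V" for r
  have diag: "adjoint_mat (U k) ** C k $ r ** U k = diag_mat (\<lambda>i. x k i $ r)" for k r
  proof -
    have eqs: "adjoint_mat (U k) ** U k = mat 1" "C k $ r = U k ** diag_mat (\<lambda>i. x k i $ r) ** adjoint_mat (U k)"
      using jd[of k] by (auto simp: jointly_diagonalizes_def unitary_def)
    have "adjoint_mat (U k) ** C k $ r ** U k =
        (adjoint_mat (U k) ** U k) ** diag_mat (\<lambda>i. x k i $ r) ** (adjoint_mat (U k) ** U k)"
      unfolding eqs(2) by (simp only: matrix_mul_assoc)
    then show ?thesis by (simp add: eqs(1))
  qed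
  have lim: "(\<lambda>k. diag_mat (\<lambda>i. x k i $ r)) \<longlonglongrightarrow> N r" for r
    unfolding diag[symmetric] N_def
    by (intro tendsto_matrix_mult tendsto_adjoint_mat tendsto_vec_nth U C)
  define y where "y j = (\<chi> r. Re (N r $ j $ j))" for j
  have xlim: "(\<lambda>k. x k j) \<longlonglongrightarrow> y j" for j
  proof (rule vec_tendstoI)
    fix r
    show "(\<lambda>k. x k j $ r) \<longlonglongrightarrow> y j $ r"
      using tendsto_Re[OF tendsto_vec_nth_nth[OF lim[of r], of j j]] by (simp add: y_def diag_mat_def)
  qed
  have "N r = diag_mat (\<lambda>i. y i $ r)" for r
  proof (rule LIMSEQ_unique[OF lim])
    show "(\<lambda>k. diag_mat (\<lambda>i. x k i $ r)) \<longlonglongrightarrow> diag_mat (\<lambda>i. y i $ r)"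
      unfolding diag_mat_def
    proof (intro tendsto_vec_lambda)
      fix i j :: 'n
      show "(\<lambda>k. if i = j then complex_of_real (x k i $ r) else 0)
              \<longlonglongrightarrow> (if i = j then complex_of_real (y i $ r) else 0)"
        by (cases "i = j") (auto intro!: tendsto_of_real tendsto_vec_nth xlim)
    qed
  qed
  moreover have "A $ r = V ** N r ** adjoint_mat V" for r
  proof -
    have "V ** N r ** adjoint_mat V = (V ** adjoint_mat V) ** A $ r ** (V ** adjoint_mat V)"
      unfolding N_def by (simp only: matrix_mul_assoc)
    then show ?thesis using V by (simp add: unitary_def)
  qed
  ultimately have "jointly_diagonalizes V y A"
    using V by (simp add: jointly_diagonalizes_def)
  then show ?thesis using xlim by (rule that)
qed

text \<open>
  With \<open>W = V\<^sup>* U\<close>, convergence of the quotients of the matrices says that all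
  \<open>W\<^sub>i\<^sub>j (x\<^sub>j - y\<^sub>i) / h\<close> converge, and the claim is that \<open>W\<^sub>i\<^sub>j (f x\<^sub>j - f y\<^sub>i) / h\<close> does. Replacing the
  difference of values of \<open>f\<close> by the slope functional \<open>L i j\<close> applied to \<open>x\<^sub>j - y\<^sub>i\<close> gives the asserted
  limit, so the error of this replacement has to vanish. If \<open>y\<^sub>i = y\<^sub>j\<close>, it is a Taylor remainder, and
  \<open>x\<^sub>j\<close> approaches \<open>y\<^sub>j\<close> at speed \<open>O(h)\<close> since \<open>W\<^sub>j\<^sub>j\<close> tends to 1. If \<open>y\<^sub>i \<noteq> y\<^sub>j\<close>, then \<open>W\<^sub>i\<^sub>j = O(h)\<close> while
  the error in \<open>f\<close> tends to 0 because the slope is exact on \<open>y\<^sub>j - y\<^sub>i\<close>.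
\<close>

lemma difference_quotient_tendsto_spectral_derivative:
  fixes A B :: "(complex^'n^'n)^'d" and h :: "nat \<Rightarrow> real"
  assumes jd: "\<And>k. jointly_diagonalizes (U k) (x k) (C k)" and jdA: "jointly_diagonalizes V y A"
    and U: "U \<longlonglongrightarrow> V" and x: "\<And>j. (\<lambda>k. x k j) \<longlonglongrightarrow> y j"
    and quot: "(\<lambda>k. (1 / h k) *\<^sub>R (C k - A)) \<longlonglongrightarrow> B"
    and f: "\<And>j. (f has_derivative f' (y j)) (at (y j))"
  shows "(\<lambda>k. (1 / h k) *\<^sub>R (matrix_fun f (C k) - matrix_fun f A))
           \<longlonglongrightarrow> spectral_derivative f f' V y B"
proof -
  have unU: "unitary (U k)" and Ck: "C k $ r = U k ** diag_mat (\<lambda>i. x k i $ r) ** adjoint_mat (U k)" for k r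
    using jd[of k] by (simp_all add: jointly_diagonalizes_def)
  have unV: "unitary V" and Ar: "A $ r = V ** diag_mat (\<lambda>i. y i $ r) ** adjoint_mat V" for r
    using jdA by (simp_all add: jointly_diagonalizes_def)
  define W where "W k = adjoint_mat V ** U k" for k
  have "W \<longlonglongrightarrow> adjoint_mat V ** V"
    unfolding W_def by (intro tendsto_matrix_mult tendsto_const U)
  then have "W \<longlonglongrightarrow> mat 1" using unV by (simp add: unitary_def)
  note Wlim = tendsto_vec_nth_nth[OF this]
  define \<beta> where "\<beta> r = adjoint_mat V ** B $ r ** V" for r
  define L where "L i j = spectral_slope f f' (y i) (y j)" for i j
  have linL: "linear (L i j)" for i j
    unfolding L_def using f by (intro linear_spectral_slope has_derivative_linear)
  have entry: "(\<lambda>k. W k $ i $ j * complex_of_real ((x k j $ r - y i $ r) / h k)) \<longlonglongrightarrow> \<beta> r $ i $ j" for i j r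
  proof -
    have "(\<lambda>k. (adjoint_mat V ** ((1 / h k) *\<^sub>R (C k - A)) $ r ** U k) $ i $ j) \<longlonglongrightarrow> \<beta> r $ i $ j"
      unfolding \<beta>_def
      by (intro tendsto_vec_nth_nth tendsto_matrix_mult tendsto_const tendsto_vec_nth[OF quot] U)
    moreover have "(adjoint_mat V ** ((1 / h k) *\<^sub>R (C k - A)) $ r ** U k) $ i $ j =
        W k $ i $ j * complex_of_real ((x k j $ r - y i $ r) / h k)" for k
    proof -
      have "adjoint_mat V ** ((1 / h k) *\<^sub>R (C k - A)) $ r ** U k =
          (1 / h k) *\<^sub>R (adjoint_mat V ** (C k $ r - A $ r) ** U k)"
        by (simp add: matrix_scalar_ac scalar_matrix_assoc)
      then show ?thesis
        unfolding Ck Ar using unitary_conj_diff_entry[OF unU unV, where i = i and j = j]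
        by (simp add: W_def scaleR_conv_of_real[where 'a = complex])
    qed
    ultimately show ?thesis by simp
  qed
  have speed: "(\<lambda>k. (1 / h k) *\<^sub>R (x k j - y j)) \<longlonglongrightarrow> (\<chi> r. Re (\<beta> r $ j $ j))" for j
  proof (rule vec_tendstoI)
    fix r
    have W1: "(\<lambda>k. W k $ j $ j) \<longlonglongrightarrow> 1" using Wlim[of j j] by (simp add: mat_def)
    have "(\<lambda>k. W k $ j $ j * complex_of_real ((x k j $ r - y j $ r) / h k) / W k $ j $ j) \<longlonglongrightarrow> \<beta> r $ j $ j / 1"
      by (intro tendsto_divide entry W1) simp
    moreover have "\<forall>\<^sub>F k in sequentially. W k $ j $ j \<noteq> 0"
      using W1 by (rule tendsto_imp_eventually_ne) simp
    then have "\<forall>\<^sub>F k in sequentially. W k $ j $ j * complex_of_real ((x k j $ r - y j $ r) / h k) / W k $ j $ j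
        = complex_of_real ((x k j $ r - y j $ r) / h k)"
      by eventually_elim simp
    ultimately have "(\<lambda>k. complex_of_real ((x k j $ r - y j $ r) / h k)) \<longlonglongrightarrow> \<beta> r $ j $ j"
      by (simp add: tendsto_cong)
    from tendsto_Re[OF this]
    show "(\<lambda>k. ((1 / h k) *\<^sub>R (x k j - y j)) $ r) \<longlonglongrightarrow> (\<chi> r. Re (\<beta> r $ j $ j)) $ r"
      by simp
  qed
  have fx: "(\<lambda>k. f (x k j)) \<longlonglongrightarrow> f (y j)" for j
    using isCont_tendsto_compose[OF has_derivative_continuous[OF f] x] .
  have Lx: "(\<lambda>k. L i j (x k j - y i)) \<longlonglongrightarrow> L i j (y j - y i)" for i j
    using linL[of i j] linear_conv_bounded_linear bounded_linear.tendsto tendsto_diff[OF x tendsto_const]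
    by blast
  have remainder: "(\<lambda>k. W k $ i $ j * complex_of_real ((f (x k j) - f (y i) - L i j (x k j - y i)) / h k)) \<longlonglongrightarrow> 0" for i j
  proof (cases "y i = y j")
    case True
    then have "L i j = f' (y j)" by (auto simp: L_def spectral_slope_def)
    then have "(\<lambda>k. (f (x k j) - f (y i) - L i j (x k j - y i)) / h k) \<longlonglongrightarrow> 0"
      using difference_quotient_remainder[OF f x speed, of j] True by simp
    from tendsto_mult[OF Wlim[of i j] tendsto_of_real[OF this]] show ?thesis by simp
  next
    case False
    then obtain r where r: "y j $ r \<noteq> y i $ r" by (metis vec_eq_iff)
    have "(\<lambda>k. x k j $ r - y i $ r) \<longlonglongrightarrow> y j $ r - y i $ r"
      by (intro tendsto_intros x)
    moreover from this have ev: "\<forall>\<^sub>F k in sequentially. x k j $ r - y i $ r \<noteq> 0"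
      using r by (intro tendsto_imp_eventually_ne) auto
    moreover have "(\<lambda>k. f (x k j) - f (y i) - L i j (x k j - y i))
        \<longlonglongrightarrow> f (y j) - f (y i) - L i j (y j - y i)"
      by (intro tendsto_intros fx Lx)
    moreover have "L i j (y j - y i) = f (y j) - f (y i)"
      unfolding L_def using False by (rule spectral_slope_secant)
    ultimately have "(\<lambda>k. (f (x k j) - f (y i) - L i j (x k j - y i)) / (x k j $ r - y i $ r))
        \<longlonglongrightarrow> 0 / (y j $ r - y i $ r)"
      using r by (intro tendsto_divide) auto
    from tendsto_mult[OF entry[of i j r] tendsto_of_real[OF this]]
    have "(\<lambda>k. W k $ i $ j * complex_of_real ((x k j $ r - y i $ r) / h k) *
          complex_of_real ((f (x k j) - f (y i) - L i j (x k j - y i)) / (x k j $ r - y i $ r))) \<longlonglongrightarrow> 0"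
      by simp
    then show ?thesis
    proof (rule Lim_transform_eventually)
      show "\<forall>\<^sub>F k in sequentially. W k $ i $ j * complex_of_real ((x k j $ r - y i $ r) / h k) *
          complex_of_real ((f (x k j) - f (y i) - L i j (x k j - y i)) / (x k j $ r - y i $ r)) =
          W k $ i $ j * complex_of_real ((f (x k j) - f (y i) - L i j (x k j - y i)) / h k)"
        using ev by eventually_elim (simp add: of_real_diff[symmetric] del: of_real_diff)
    qed
  qed
  define M where "M = (\<chi> i j. \<Sum>r\<in>UNIV. complex_of_real (L i j (axis r 1)) * \<beta> r $ i $ j)"
  have M_eq: "M $ i $ j = (\<Sum>r\<in>UNIV. complex_of_real (L i j (axis r 1)) * \<beta> r $ i $ j)" for i j
    by (simp add: M_def)
  have M: "(\<lambda>k. W k $ i $ j * complex_of_real ((f (x k j) - f (y i)) / h k)) \<longlonglongrightarrow> M $ i $ j" for i j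
  proof -
    have "(\<lambda>k. W k $ i $ j * complex_of_real ((f (x k j) - f (y i) - L i j (x k j - y i)) / h k)
          + (\<Sum>r\<in>UNIV. complex_of_real (L i j (axis r 1)) *
               (W k $ i $ j * complex_of_real ((x k j $ r - y i $ r) / h k)))) \<longlonglongrightarrow> 0 + M $ i $ j"
      unfolding M_eq by (intro tendsto_add remainder tendsto_sum tendsto_mult tendsto_const entry)
    moreover have "(\<Sum>r\<in>UNIV. complex_of_real (L i j (axis r 1)) *
          (W k $ i $ j * complex_of_real ((x k j $ r - y i $ r) / h k))) =
        W k $ i $ j * complex_of_real (L i j (x k j - y i) / h k)" for k
      unfolding linear_functional_vec_expansion[OF linL, of i j "x k j - y i"]
      by (simp add: sum_distrib_left sum_divide_distrib algebra_simps)
    moreover have "W k $ i $ j * complex_of_real ((f (x k j) - f (y i) - L i j (x k j - y i)) / h k)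
        + W k $ i $ j * complex_of_real (L i j (x k j - y i) / h k)
        = W k $ i $ j * complex_of_real ((f (x k j) - f (y i)) / h k)" for k
      by (simp only: distrib_left[symmetric] of_real_add[symmetric] diff_divide_distrib diff_add_cancel)
    ultimately show ?thesis by (simp only: add_0)
  qed
  define N where "N k = adjoint_mat V ** ((1 / h k) *\<^sub>R (matrix_fun f (C k) - matrix_fun f A)) ** U k" for k
  have "N \<longlonglongrightarrow> M"
  proof (intro vec_tendstoI)
    fix i j
    have "N k $ i $ j = W k $ i $ j * complex_of_real ((f (x k j) - f (y i)) / h k)" for k
    proof -
      have "N k = (1 / h k) *\<^sub>R (adjoint_mat V ** (matrix_fun f (C k) - matrix_fun f A) ** U k)"
        unfolding N_def by (simp add: matrix_scalar_ac scalar_matrix_assoc)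
      then show ?thesis
        unfolding matrix_fun_eq[OF jd] matrix_fun_eq[OF jdA]
        using unitary_conj_diff_entry[OF unU unV, where i = i and j = j]
        by (simp add: W_def scaleR_conv_of_real[where 'a = complex])
    qed
    then show "(\<lambda>k. N k $ i $ j) \<longlonglongrightarrow> M $ i $ j" using M by simp
  qed
  then have "(\<lambda>k. V ** N k ** adjoint_mat (U k)) \<longlonglongrightarrow> V ** M ** adjoint_mat V"
    by (intro tendsto_matrix_mult tendsto_adjoint_mat tendsto_const U)
  moreover have "V ** N k ** adjoint_mat (U k) = (1 / h k) *\<^sub>R (matrix_fun f (C k) - matrix_fun f A)" for k
  proof -
    have "V ** N k ** adjoint_mat (U k) = (V ** adjoint_mat V) **
        ((1 / h k) *\<^sub>R (matrix_fun f (C k) - matrix_fun f A)) ** (U k ** adjoint_mat (U k))"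
      unfolding N_def by (simp only: matrix_mul_assoc)
    then show ?thesis using unU[of k] unV by (simp add: unitary_def)
  qed
  ultimately show ?thesis
    unfolding spectral_derivative_def M_def L_def \<beta>_def by simp
qed

lemma has_vector_derivative_iff_quotient:
  fixes g :: "real \<Rightarrow> 'a::real_normed_vector"
  shows "(g has_vector_derivative D) (at t within I) \<longleftrightarrow>
    ((\<lambda>s. (1 / (s - t)) *\<^sub>R (g s - g t)) \<longlongrightarrow> D) (at t within I)"
proof -
  have "(g has_vector_derivative D) (at t within I) \<longleftrightarrow>
    ((\<lambda>s. norm (g s - g t - (s - t) *\<^sub>R D) / norm (s - t)) \<longlongrightarrow> 0) (at t within I)"
    by (simp add: has_vector_derivative_def has_derivative_iff_norm bounded_linear_scaleR_left)
  also have "\<dots> \<longleftrightarrow> ((\<lambda>s. norm ((1 / (s - t)) *\<^sub>R (g s - g t) - D)) \<longlongrightarrow> 0) (at t within I)"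
  proof (rule Lim_cong_within)
    fix s assume "s \<noteq> t"
    then have "g s - g t - (s - t) *\<^sub>R D = (s - t) *\<^sub>R ((1 / (s - t)) *\<^sub>R (g s - g t) - D)"
      by (simp add: scaleR_diff_right)
    then have "norm (g s - g t - (s - t) *\<^sub>R D) = norm (s - t) * norm ((1 / (s - t)) *\<^sub>R (g s - g t) - D)"
      by (metis norm_scaleR real_norm_def)
    then show "norm (g s - g t - (s - t) *\<^sub>R D) / norm (s - t) = norm ((1 / (s - t)) *\<^sub>R (g s - g t) - D)"
      using \<open>s \<noteq> t\<close> by simp
  qed simp_all
  also have "\<dots> \<longleftrightarrow> ((\<lambda>s. (1 / (s - t)) *\<^sub>R (g s - g t)) \<longlongrightarrow> D) (at t within I)"
    by (simp add: tendsto_norm_zero_iff LIM_zero_iff)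
  finally show ?thesis .
qed

text \<open>
  If the difference quotient did not converge, it would stay away from the candidate along some
  sequence. A subsequence with convergent diagonalizing unitaries contradicts this: its limiting
  unitary \<open>V'\<close> may differ from \<open>V\<close>, but the candidate is the same for both.
\<close>

lemma matrix_fun_has_vector_derivative:
  fixes S :: "real \<Rightarrow> (complex^'n^'n)^'d"
  assumes CS: "\<And>s. s \<in> I \<Longrightarrow> S s \<in> CS"
    and S: "(S has_vector_derivative B) (at t within I)"
    and jdA: "jointly_diagonalizes V y (S t)"
    and f: "\<And>j. (f has_derivative f' (y j)) (at (y j))"
  shows "((\<lambda>s. matrix_fun f (S s)) has_vector_derivative spectral_derivative f f' V y B) (at t within I)"
  unfolding has_vector_derivative_iff_quotient
proof (rule ccontr)
  let ?q = "\<lambda>s. (1 / (s - t)) *\<^sub>R (matrix_fun f (S s) - matrix_fun f (S t))"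
  let ?D = "spectral_derivative f f' V y B"
  assume "\<not> (?q \<longlongrightarrow> ?D) (at t within I)"
  then obtain e where "e > 0" and "\<exists>\<^sub>F s in at t within I. \<not> dist (?q s) ?D < e"
    by (auto simp: tendsto_iff frequently_def)
  then have "\<exists>\<^sub>F s in at t within I. s \<in> I \<and> \<not> dist (?q s) ?D < e"
    by (auto simp: frequently_at)
  then obtain s where s: "filterlim s (at t within I) sequentially"
    and far: "\<And>k. s k \<in> I \<and> \<not> dist (?q (s k)) ?D < e"
    using frequently_atE by blast
  have "\<exists>U x. jointly_diagonalizes U x (S (s k))" for k
    using CS_jointly_diagonalizable CS far by metis
  then obtain U x where jd: "\<And>k. jointly_diagonalizes (U k) (x k) (S (s k))" by metis
  then have "\<And>k. unitary (U k)" by (simp add: jointly_diagonalizes_def)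
  then obtain V' \<phi> where \<phi>: "strict_mono \<phi>" "(U \<circ> \<phi>) \<longlonglongrightarrow> V'" and V': "unitary V'"
    by (rule unitary_convergent_subsequence)
  have s\<phi>: "filterlim (\<lambda>k. s (\<phi> k)) (at t within I) sequentially"
    using filterlim_compose[OF s filterlim_subseq[OF \<phi>(1)]] .
  have Slim: "(\<lambda>k. S (s (\<phi> k))) \<longlonglongrightarrow> S t"
    using filterlim_compose[OF _ s\<phi>] has_vector_derivative_continuous[OF S]
    unfolding continuous_within by blast
  have quot: "(\<lambda>k. (1 / (s (\<phi> k) - t)) *\<^sub>R (S (s (\<phi> k)) - S t)) \<longlonglongrightarrow> B"
    using filterlim_compose[OF _ s\<phi>] S unfolding has_vector_derivative_iff_quotient by blast
  obtain y' where y': "jointly_diagonalizes V' y' (S t)" and x: "\<And>j. (\<lambda>k. x (\<phi> k) j) \<longlonglongrightarrow> y' j"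
    using spectrum_tendsto[of "U \<circ> \<phi>" "x \<circ> \<phi>" "\<lambda>k. S (s (\<phi> k))" V' "S t"] jd \<phi>(2) V' Slim
    by (auto simp: o_def)
  have f': "(f has_derivative f' (y' j)) (at (y' j))" for j
    using f joint_spectrum_eq[OF y'] joint_spectrum_eq[OF jdA] by (metis rangeE rangeI)
  have "(\<lambda>k. ?q (s (\<phi> k))) \<longlonglongrightarrow> spectral_derivative f f' V' y' B"
    by (rule difference_quotient_tendsto_spectral_derivative[OF jd y' _ x quot f'])
      (use \<phi>(2) in \<open>simp add: o_def\<close>)
  then have "(\<lambda>k. ?q (s (\<phi> k))) \<longlonglongrightarrow> ?D"
    by (simp only: spectral_derivative_unique[OF y' jdA])
  then have "\<forall>\<^sub>F k in sequentially. dist (?q (s (\<phi> k))) ?D < e"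
    using \<open>e > 0\<close> by (rule tendstoD)
  then show False
    using far by (auto dest: eventually_happens)
qed

lemma nondegenerate_interval_at_within:
  assumes "nondegenerate_interval I" "t \<in> I" shows "at t within I \<noteq> bot"
  using assms connected_imp_perfect[of I t] is_interval_connected[of I]
  by (auto simp: nondegenerate_interval_def trivial_limit_within)

theorem theorem3p1:
  fixes S :: "real \<Rightarrow> (complex^'n^'n)^'d"
    and I :: "real set"
    and \<Omega> :: "(real^'d) set"
    and f :: "real^'d \<Rightarrow> real"
  assumes "C1_curve_in_CS I S"
    and "open \<Omega>"
    and "\<And>t. t \<in> I \<Longrightarrow> joint_spectrum (S t) \<subseteq> \<Omega>"
    and "C1_fun_on \<Omega> f"
  shows "(\<forall>t\<in>I. (\<lambda>t. matrix_fun f (S t)) differentiable (at t within I)) \<and>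
         (\<forall>t\<in>I. \<forall>J. \<forall>T :: real \<Rightarrow> (complex^'n^'n)^'d.
            C1_curve_in_CS J T \<and> 0 \<in> J \<and> T 0 = S t \<and>
            vector_derivative T (at 0 within J) = vector_derivative S (at t within I) \<longrightarrow>
            ((\<lambda>u. matrix_fun f (T u)) has_vector_derivative
               vector_derivative (\<lambda>u. matrix_fun f (S u)) (at t within I)) (at 0 within J))"
proof -
  from assms(4) obtain g where "\<forall>x\<in>\<Omega>. (f has_derivative blinfun_apply (g x)) (at x)"
    unfolding C1_fun_on_def by blast
  then obtain f' where f': "\<And>x. x \<in> \<Omega> \<Longrightarrow> (f has_derivative f' x) (at x)"
    using that[of "\<lambda>x. blinfun_apply (g x)"] by blast
  have deriv: "((\<lambda>u. matrix_fun f (R u)) has_vector_derivative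
      spectral_derivative f f' V y (vector_derivative R (at s within K))) (at s within K)"
    if R: "C1_curve_in_CS K R" "s \<in> K" and jd: "jointly_diagonalizes V y (R s)"
      and spec: "joint_spectrum (R s) \<subseteq> \<Omega>"
    for K s V y and R :: "real \<Rightarrow> (complex^'n^'n)^'d"
  proof (rule matrix_fun_has_vector_derivative[where S = R and t = s, OF _ _ jd])
    show "R u \<in> CS" if "u \<in> K" for u
      using R that by (simp add: C1_curve_in_CS_def)
    show "(R has_vector_derivative vector_derivative R (at s within K)) (at s within K)"
      using R vector_derivative_works by (auto simp: C1_curve_in_CS_def)
    show "(f has_derivative f' (y j)) (at (y j))" for j
      using f' spec joint_spectrum_eq[OF jd] by blast
  qed
  have "\<exists>D. ((\<lambda>u. matrix_fun f (S u)) has_vector_derivative D) (at t within I) \<and>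
      (\<forall>J. \<forall>T :: real \<Rightarrow> (complex^'n^'n)^'d.
        C1_curve_in_CS J T \<and> 0 \<in> J \<and> T 0 = S t \<and>
        vector_derivative T (at 0 within J) = vector_derivative S (at t within I) \<longrightarrow>
        ((\<lambda>u. matrix_fun f (T u)) has_vector_derivative D) (at 0 within J))"
    if t: "t \<in> I" for t
  proof -
    have "S t \<in> CS" using assms(1) t by (simp add: C1_curve_in_CS_def)
    then obtain V y where jd: "jointly_diagonalizes V y (S t)"
      by (rule CS_jointly_diagonalizable)
    show ?thesis
      using deriv[OF assms(1) t jd assms(3)[OF t]] deriv[of _ _ 0 V y] jd assms(3)[OF t] by metis
  qed
  moreover have "vector_derivative (\<lambda>u. matrix_fun f (S u)) (at t within I) = D"
    if "((\<lambda>u. matrix_fun f (S u)) has_vector_derivative D) (at t within I)" "t \<in> I" for t D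
    using vector_derivative_within[OF nondegenerate_interval_at_within that(1)] assms(1) that(2)
    by (simp add: C1_curve_in_CS_def)
  ultimately show ?thesis
    by (metis differentiableI_vector)
qed

end
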